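(* If $2<p\le q<\infty$, then $\mathcal{L}\colon L^p(\mathbb{R}_+)\to A^q_{q/p'-2}(\mathbb{C}_+)$ is bounded, i.e. there is a constant $C>0$ such that $\mathcal{L}f\in A^q_{q/p'-2}(\mathbb{C}_+)$ and $\|\mathcal{L}f\|_{A^q_{q/p'-2}(\mathbb{C}_+)}\le C\|f\|_{L^p(\mathbb{R}_+)}$ for all $f\in L^p(\mathbb{R}_+)$.
   Context: $\mathbb{R}_+=(0,\infty)$ and $\mathbb{C}_+=\{z\in\mathbb{C}:\operatorname{Im}z>0\}$. The conjugate exponent is $p'=p/(p-1)$. The Laplace transform is $\mathcal{L}f(z)=\int_0^\infty f(t)e^{2\pi i tz}\,dt$ for $z\in\mathbb{C}_+$. For $\beta>-1$, the standard weighted Bergman space $A^q_\beta(\mathbb{C}_+)$ is the space of analytic functions $F\colon\mathbb{C}_+\to\mathbb{C}$ such that $\|F\|_{A^q_\beta(\mathbb{C}_+)}^q:=\int_0^\infty\int_{\mathbb{R}}|F(x+iy)|^q y^\beta\,dx\,dy<\infty$. *)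

theory Defs
  imports "HOL-Analysis.Analysis"
begin

definition upper_half_plane :: "complex set" where
  "upper_half_plane = {z. Im z > 0}"

definition conjugate_exponent :: "real \<Rightarrow> real" where
  "conjugate_exponent p = p / (p - 1)"

text \<open>Elements of \<open>L\<^sup>p\<close> are represented by functions, not by classes modulo equality
  almost everywhere; the seminorm and the Laplace transform depend only on the class.\<close>

definition Lp_space :: "'a measure \<Rightarrow> real \<Rightarrow> ('a \<Rightarrow> complex) set" where
  "Lp_space M p = {f \<in> borel_measurable M. integrable M (\<lambda>x. cmod (f x) powr p)}"

definition Lp_norm :: "'a measure \<Rightarrow> real \<Rightarrow> ('a \<Rightarrow> complex) \<Rightarrow> real" where
  "Lp_norm M p f = (LINT x|M. cmod (f x) powr p) powr (1 / p)"

abbreviation lebesgue_pos :: "real measure" where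
  "lebesgue_pos \<equiv> lebesgue_on {0<..}"

definition laplace :: "(real \<Rightarrow> complex) \<Rightarrow> complex \<Rightarrow> complex" where
  "laplace f z = (LINT t|lebesgue_pos. f t * exp (2 * of_real pi * \<i> * of_real t * z))"

text \<open>The integral is taken in \<open>[0, \<infinity>]\<close>, so that its finiteness is a genuine condition.\<close>

definition bergman_integral :: "real \<Rightarrow> real \<Rightarrow> (complex \<Rightarrow> complex) \<Rightarrow> ennreal" where
  "bergman_integral q \<beta> F =
     (\<integral>\<^sup>+y\<in>{0<..}. (\<integral>\<^sup>+x. ennreal (cmod (F (Complex x y)) powr q * y powr \<beta>) \<partial>lborel) \<partial>lborel)"

text \<open>Only the values on the upper half-plane matter. The space is meant for \<open>\<beta> > -1\<close>.\<close>

definition bergman_space :: "real \<Rightarrow> real \<Rightarrow> (complex \<Rightarrow> complex) set" where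
  "bergman_space q \<beta> = {F. F holomorphic_on upper_half_plane \<and> bergman_integral q \<beta> F < \<infinity>}"

definition bergman_norm :: "real \<Rightarrow> real \<Rightarrow> (complex \<Rightarrow> complex) \<Rightarrow> real" where
  "bergman_norm q \<beta> F = enn2real (bergman_integral q \<beta> F) powr (1 / q)"

text \<open>On \<open>L\<^sup>p\<close> with \<open>p \<ge> 1\<close> the integral defining the Laplace transform converges
  absolutely, so the default value \<open>0\<close> of a divergent Bochner integral never occurs.\<close>

lemma laplace_integrable:
  assumes p: "p \<ge> 1" and f: "f \<in> Lp_space lebesgue_pos p" and z: "z \<in> upper_half_plane"
  shows "integrable lebesgue_pos (\<lambda>t. f t * exp (2 * of_real pi * \<i> * of_real t * z))"
proof (rule Bochner_Integration.integrable_bound)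
  define a where "a = 2 * pi * Im z"
  have a: "a > 0" using z by (simp add: a_def upper_half_plane_def)
  have "(\<lambda>t. exp (- (t * a))) integrable_on {0..}"
    using integrable_on_exp_minus_to_infinity[OF a, of 0] by (simp add: mult.commute)
  then have "(\<lambda>t. exp (- (t * a))) absolutely_integrable_on {0..}"
    by (intro nonnegative_absolutely_integrable_1) auto
  then have "(\<lambda>t. exp (- (t * a))) absolutely_integrable_on {0<..}"
    by (rule set_integrable_subset) auto
  then have E: "integrable lebesgue_pos (\<lambda>t. exp (- (t * a)))"
    by (simp add: integrable_restrict_space set_integrable_def)
  show "integrable lebesgue_pos (\<lambda>t. exp (- (t * a)) + cmod (f t) powr p)"
    using E f by (auto simp: Lp_space_def)
  have "continuous_on UNIV (\<lambda>t. exp (2 * of_real pi * \<i> * of_real t * z))"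
    by (intro continuous_intros)
  then have "(\<lambda>t. exp (2 * of_real pi * \<i> * of_real t * z)) \<in> borel_measurable lebesgue_pos"
    by (intro measurable_restrict_space1 measurable_completion)
      (simp add: borel_measurable_continuous_onI)
  then show "(\<lambda>t. f t * exp (2 * of_real pi * \<i> * of_real t * z)) \<in> borel_measurable lebesgue_pos"
    using f by (auto simp: Lp_space_def)
  have bd: "cmod (f t * exp (2 * of_real pi * \<i> * of_real t * z))
      \<le> norm (exp (- (t * a)) + cmod (f t) powr p)" if t: "t > 0" for t
  proof -
    have e: "cmod (exp (2 * of_real pi * \<i> * of_real t * z)) = exp (- (t * a))"
      by (simp add: a_def algebra_simps)
    have e1: "exp (- (t * a)) \<le> 1" using t a by simp
    have "cmod (f t) * exp (- (t * a)) \<le> exp (- (t * a)) + cmod (f t) powr p"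
    proof (cases "cmod (f t) \<le> 1")
      case True
      then have "cmod (f t) * exp (- (t * a)) \<le> exp (- (t * a))"
        by (simp add: mult_left_le_one_le)
      then show ?thesis by (smt (verit) powr_ge_zero)
    next
      case False
      then have "cmod (f t) powr 1 \<le> cmod (f t) powr p" using p by (intro powr_mono) auto
      moreover have "cmod (f t) * exp (- (t * a)) \<le> cmod (f t)"
        using e1 by (simp add: mult_right_le_one_le)
      ultimately show ?thesis using False by (smt (verit) exp_gt_zero powr_one)
    qed
    then show ?thesis by (simp add: norm_mult e del: norm_exp_eq_Re)
  qed
  show "AE t in lebesgue_pos. cmod (f t * exp (2 * of_real pi * \<i> * of_real t * z))
      \<le> norm (exp (- (t * a)) + cmod (f t) powr p)"
    by (rule AE_I2) (use bd in auto)
qed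

end

theory Submission
  imports Defs "HOL-Probability.Characteristic_Functions"
begin

text \<open>For fixed \<open>y > 0\<close> the function \<open>x \<mapsto> laplace f (x + iy)\<close> is the Fourier transform of
  \<open>h\<^sub>y(t) = f(t) e\<^bsup>-2\<pi>yt\<^esup>\<close>. As \<open>q > 2\<close>, the Hausdorff-Young inequality bounds its
  \<open>L\<^sup>q\<close> norm by the \<open>L\<^bsup>q'\<^esup>\<close> norm of \<open>h\<^sub>y\<close>, where \<open>q' = q/(q - 1)\<close>; up to a constant
  this inequality is the Marcinkiewicz interpolation of the trivial \<open>L\<^sup>1\<close>-\<open>L\<^sup>\<infinity>\<close> bound
  with Plancherel. What remains is an estimate for the real Laplace transform of \<open>|f|\<^bsup>q'\<^esup>\<close>
  from \<open>L\<^bsup>p/q'\<^esup>\<close> to a weighted \<open>L\<^bsup>q-1\<^esup>\<close>. Its kernel is homogeneous and \<open>p/q' > 1\<close>, so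
  Jensen's inequality with respect to the weight \<open>t\<^bsup>-1/2\<^esup> e\<^bsup>-2\<pi>q'yt\<^esup>\<close> and Tonelli's theorem suffice.\<close>

section \<open>Plancherel's inequality\<close>

text \<open>The sign and the factor \<open>2 * pi\<close> agree with the exponent in
  \<open>laplace\<close>. With this normalisation the constant in Plancherel's inequality is
  \<open>1\<close>.\<close>

definition fourier :: "(real \<Rightarrow> complex) \<Rightarrow> real \<Rightarrow> complex" where
  "fourier h x = (CLINT t|lborel. h t * iexp (2 * pi * t * x))"

lemma borel_measurable_fourier [measurable]:
  assumes [measurable]: "h \<in> borel_measurable borel"
  shows "fourier h \<in> borel_measurable borel"
  unfolding fourier_def by measurable

lemma integrable_mult_iexp:
  assumes "integrable lborel h"
  shows "integrable lborel (\<lambda>t. h t * iexp (2 * pi * t * x))"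
  using assms by (rule Bochner_Integration.integrable_bound) (use assms in \<open>auto simp: norm_mult\<close>)

lemma norm_fourier_le:
  "norm (fourier h x) \<le> (LINT t|lborel. norm (h t))"
  unfolding fourier_def
  by (rule order_trans[OF integral_norm_bound]) (simp add: norm_mult)

text \<open>The substitution \<open>v = 2 * pi * s * x\<close> leads to the characteristic function
  of the standard normal distribution at \<open>u / s\<close>, which is again a Gaussian.\<close>

lemma fourier_gaussian:
  assumes s: "s > 0"
  shows "fourier (\<lambda>x. of_real (exp (- (2 * pi * s * x)\<^sup>2 / 2))) u = of_real (normal_density 0 s u)"
proof -
  define E where "E v = complex_of_real (exp (- v\<^sup>2 / 2)) * iexp (u / s * v)" for v
  have "of_real (exp (- (u / s)\<^sup>2 / 2)) = char std_normal_distribution (u / s)"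
    by (simp add: char_std_normal_distribution)
  also have "\<dots> = (CLINT v|lborel. of_real (std_normal_density v) * iexp (u / s * v))"
    by (simp add: char_def integral_density scaleR_conv_of_real)
  also have "\<dots> = (CLINT v|lborel. of_real (1 / sqrt (2 * pi)) * E v)"
    by (intro Bochner_Integration.integral_cong) (auto simp: E_def normal_density_def)
  also have "\<dots> = of_real (1 / sqrt (2 * pi)) * (CLINT v|lborel. E v)"
    by simp
  also have "(CLINT v|lborel. E v) = \<bar>2 * pi * s\<bar> *\<^sub>R (CLINT x|lborel. E (0 + (2 * pi * s) * x))"
    using s by (intro lborel_integral_real_affine) auto
  also have "(CLINT x|lborel. E (0 + (2 * pi * s) * x))
      = fourier (\<lambda>x. of_real (exp (- (2 * pi * s * x)\<^sup>2 / 2))) u"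
    unfolding fourier_def E_def using s
    by (intro Bochner_Integration.integral_cong) (auto simp: field_simps)
  finally have "complex_of_real (exp (- (u / s)\<^sup>2 / 2))
      = of_real (2 * pi * s / sqrt (2 * pi)) * fourier (\<lambda>x. of_real (exp (- (2 * pi * s * x)\<^sup>2 / 2))) u"
    using s by (simp add: scaleR_conv_of_real)
  moreover have "2 * pi * s / sqrt (2 * pi) * normal_density 0 s u = exp (- (u / s)\<^sup>2 / 2)"
    using s by (simp add: normal_density_def real_sqrt_mult field_simps power_divide)
  ultimately have "complex_of_real (2 * pi * s / sqrt (2 * pi)) * fourier (\<lambda>x. of_real (exp (- (2 * pi * s * x)\<^sup>2 / 2))) u
      = of_real (2 * pi * s / sqrt (2 * pi)) * of_real (normal_density 0 s u)"
    by (metis of_real_mult)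
  then show ?thesis using s by simp
qed

lemma integrable_gaussian:
  assumes "s > 0"
  shows "integrable lborel (\<lambda>x::real. exp (- (2 * pi * s * x)\<^sup>2 / 2))"
proof -
  have "integrable lborel (\<lambda>x. sqrt (2 * pi) * std_normal_density (0 + (2 * pi * s) * x))"
    using assms by (intro integrable_mult_right lborel_integrable_real_affine) auto
  then show ?thesis by (simp add: normal_density_def)
qed

text \<open>The product \<open>norm (a x) * norm (b t)\<close> is an integrable majorant. This
  justifies the two interchanges of complex integrals in \<open>gaussian_plancherel\<close>.\<close>

lemma integrable_product_kernel:
  fixes a b :: "real \<Rightarrow> complex"
  assumes a: "integrable lborel a" and b: "integrable lborel b"
    and k[measurable]: "(\<lambda>(x, t). k x t) \<in> borel_measurable (lborel \<Otimes>\<^sub>M lborel)"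
    and k1: "\<And>x t. norm (k x t :: complex) \<le> 1"
  shows "integrable (lborel \<Otimes>\<^sub>M lborel) (\<lambda>(x, t). a x * b t * k x t)"
proof -
  have [measurable]: "a \<in> borel_measurable lborel" "b \<in> borel_measurable lborel"
    using a b by auto
  have "integrable (lborel \<Otimes>\<^sub>M lborel) (\<lambda>(x, t). a x * b t)"
    using a b by (intro lborel_pair.Fubini_integrable) (auto simp: norm_mult)
  then show ?thesis
    by (rule Bochner_Integration.integrable_bound)
      (auto simp: norm_mult k1 intro!: AE_I2 mult_right_le_one_le)
qed

text \<open>The Gaussian factor makes Fubini applicable; its Fourier transform is a probability density,
  so Schur's test gives the constant \<open>1\<close>.\<close>

lemma gaussian_plancherel:
  assumes s: "s > 0" and h: "integrable lborel h"
  shows "(\<integral>\<^sup>+x. ennreal (exp (- (2 * pi * s * x)\<^sup>2 / 2) * (norm (fourier h x))\<^sup>2) \<partial>lborel)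
    \<le> (\<integral>\<^sup>+t. ennreal ((norm (h t))\<^sup>2) \<partial>lborel)"
proof -
  define \<phi> where "\<phi> x = exp (- (2 * pi * s * x)\<^sup>2 / 2)" for x
  define F where "F = fourier h"
  have [measurable]: "h \<in> borel_measurable borel" using h by auto
  have [measurable]: "\<phi> \<in> borel_measurable borel" "F \<in> borel_measurable borel"
    unfolding F_def \<phi>_def[abs_def] by measurable
  have \<phi>: "integrable lborel (\<lambda>x. complex_of_real (\<phi> x))"
    unfolding \<phi>_def using integrable_gaussian[OF s] by (rule integrable_of_real)
  \<comment> \<open>As \<open>F\<close> is bounded, the Gaussian alone makes the following integrals
    converge; square integrability of \<open>F\<close> is not yet known.\<close>
  define B where "B = (LINT t|lborel. norm (h t))"
  have FB: "norm (F x) \<le> B" for x unfolding B_def F_def by (rule norm_fourier_le)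
  have \<phi>F: "integrable lborel (\<lambda>x. of_real (\<phi> x) * F x)"
  proof (rule Bochner_Integration.integrable_bound)
    show "integrable lborel (\<lambda>x. of_real B * complex_of_real (\<phi> x))" using \<phi> by simp
    show "AE x in lborel. norm (of_real (\<phi> x) * F x) \<le> norm (of_real B * complex_of_real (\<phi> x))"
      using FB by (intro AE_I2) (auto simp: norm_mult \<phi>_def intro: order_trans[OF FB abs_ge_self])
  qed measurable
  have \<phi>FF: "integrable lborel (\<lambda>x. \<phi> x * (norm (F x))\<^sup>2)"
  proof (rule Bochner_Integration.integrable_bound)
    show "integrable lborel (\<lambda>x. B\<^sup>2 * \<phi> x)"
      using integrable_gaussian[OF s] by (auto simp: \<phi>_def)
    show "AE x in lborel. norm (\<phi> x * (norm (F x))\<^sup>2) \<le> norm (B\<^sup>2 * \<phi> x)"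
      using FB by (intro AE_I2) (auto simp: \<phi>_def abs_mult intro!: power_mono)
  qed measurable
  define K where "K = normal_density 0 s"
  have [measurable]: "K \<in> borel_measurable borel" by (simp add: K_def)
  have K0: "K x \<ge> 0" for x by (simp add: K_def)
  have K1: "(\<integral>\<^sup>+x. ennreal (K x) \<partial>lborel) = 1"
    using s by (subst nn_integral_eq_integral) (auto simp: K_def)
  have K1': "(\<integral>\<^sup>+x. ennreal (K (x - t)) \<partial>lborel) = 1" for t
    using nn_integral_real_affine[of "\<lambda>x. ennreal (K x)" 1 "-t"] K1 by simp
  have Kmult: "(\<integral>\<^sup>+u. ennreal (c * K (u - t)) \<partial>lborel) = ennreal c" if "c \<ge> 0" for c t
    using that K0 by (simp add: ennreal_mult nn_integral_cmult K1')
  have Ksym: "K (x - t) = K (t - x)" for x t by (simp add: K_def normal_density_def power2_commute)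
  have cnjF: "cnj (F x) = (CLINT t|lborel. cnj (h t) * iexp (- (2 * pi * t * x)))" for x
    unfolding F_def fourier_def
    by (subst Bochner_Integration.integral_cnj[symmetric])
      (auto intro!: Bochner_Integration.integral_cong simp: exp_cnj)
  have ch: "integrable lborel (\<lambda>t. cnj (h t))" using h by simp
  \<comment> \<open>After Fubini the Gaussian is transformed first, so the damped inverse transform
    of \<open>F\<close> is the convolution of \<open>h\<close> with the kernel
    \<open>K\<close>.\<close>
  have inner: "(CLINT x|lborel. of_real (\<phi> x) * F x * iexp (- (2 * pi * t * x)))
      = (CLINT u|lborel. h u * of_real (K (u - t)))" for t
  proof -
    have "(CLINT x|lborel. of_real (\<phi> x) * F x * iexp (- (2 * pi * t * x)))
       = (CLINT x|lborel. CLINT u|lborel. of_real (\<phi> x) * h u * iexp (2 * pi * (u - t) * x))"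
    proof (rule Bochner_Integration.integral_cong[OF refl])
      fix x
      have "of_real (\<phi> x) * F x * iexp (- (2 * pi * t * x))
        = (CLINT u|lborel. (of_real (\<phi> x) * iexp (- (2 * pi * t * x))) * (h u * iexp (2 * pi * u * x)))"
        by (simp add: F_def fourier_def)
      also have "\<dots> = (CLINT u|lborel. of_real (\<phi> x) * h u * iexp (2 * pi * (u - t) * x))"
        by (intro Bochner_Integration.integral_cong)
          (auto simp: exp_add[symmetric] algebra_simps mult_exp_exp)
      finally show "of_real (\<phi> x) * F x * iexp (- (2 * pi * t * x)) = \<dots>" .
    qed
    also have "\<dots> = (CLINT u|lborel. CLINT x|lborel. of_real (\<phi> x) * h u * iexp (2 * pi * (u - t) * x))"
      by (rule lborel_pair.Fubini_integral[symmetric])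
        (intro integrable_product_kernel \<phi> h; simp)
    also have "\<dots> = (CLINT u|lborel. h u * fourier (\<lambda>x. of_real (\<phi> x)) (u - t))"
      unfolding fourier_def integral_mult_right_zero[symmetric]
      by (intro Bochner_Integration.integral_cong) (auto simp: algebra_simps)
    also have "\<dots> = (CLINT u|lborel. h u * of_real (K (u - t)))"
      unfolding \<phi>_def K_def using fourier_gaussian[OF s] by simp
    finally show ?thesis .
  qed
  \<comment> \<open>Expanding the second factor of \<open>F x * cnj (F x)\<close> yields a quadratic
    form in \<open>h\<close> with kernel \<open>K (u - t)\<close>.\<close>
  have "complex_of_real (LINT x|lborel. \<phi> x * (norm (F x))\<^sup>2)
     = (CLINT x|lborel. of_real (\<phi> x) * F x * cnj (F x))"
    unfolding integral_complex_of_real[symmetric]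
    by (intro Bochner_Integration.integral_cong) (simp_all only: of_real_mult complex_norm_square mult.assoc)
  also have "\<dots> = (CLINT x|lborel. CLINT t|lborel. of_real (\<phi> x) * F x * cnj (h t) * iexp (- (2 * pi * t * x)))"
    unfolding cnjF by (simp add: mult.assoc)
  also have "\<dots> = (CLINT t|lborel. CLINT x|lborel. of_real (\<phi> x) * F x * cnj (h t) * iexp (- (2 * pi * t * x)))"
    by (rule lborel_pair.Fubini_integral[symmetric])
      (intro integrable_product_kernel \<phi>F ch; simp)
  also have "\<dots> = (CLINT t|lborel. cnj (h t) * (CLINT u|lborel. h u * of_real (K (u - t))))"
    unfolding inner[symmetric] integral_mult_right_zero[symmetric]
    by (intro Bochner_Integration.integral_cong) (auto simp: algebra_simps)
  finally have eq: "complex_of_real (LINT x|lborel. \<phi> x * (norm (F x))\<^sup>2) = \<dots>" .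
  \<comment> \<open>For non-integrable \<open>f\<close> the Bochner integral is \<open>0\<close> by
    default, so the bound applies to the convolution integrals as they stand.\<close>
  have norm_int: "ennreal (norm (integral\<^sup>L lborel f)) \<le> (\<integral>\<^sup>+x. ennreal (norm (f x)) \<partial>lborel)"
    for f :: "real \<Rightarrow> complex"
    by (cases "integrable lborel f") (auto simp: integral_norm_bound_ennreal not_integrable_integral_eq)
  have "(\<integral>\<^sup>+x. ennreal (\<phi> x * (norm (F x))\<^sup>2) \<partial>lborel) = ennreal (LINT x|lborel. \<phi> x * (norm (F x))\<^sup>2)"
    using \<phi>FF by (intro nn_integral_eq_integral) (auto simp: \<phi>_def)
  also have "\<dots> \<le> ennreal (norm (complex_of_real (LINT x|lborel. \<phi> x * (norm (F x))\<^sup>2)))"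
    by (intro ennreal_leI) simp
  also have "\<dots> \<le> (\<integral>\<^sup>+t. ennreal (norm (cnj (h t) * (CLINT u|lborel. h u * of_real (K (u - t))))) \<partial>lborel)"
    unfolding eq by (rule norm_int)
  \<comment> \<open>Schur's test: the arithmetic-geometric mean inequality splits
    \<open>norm (h t) * norm (h u)\<close>, and \<open>K (u - t)\<close> has mass \<open>1\<close>
    in either variable.\<close>
  also have "\<dots> \<le> (\<integral>\<^sup>+t. \<integral>\<^sup>+u. ennreal ((norm (h t))\<^sup>2 / 2 * K (u - t)) + ennreal ((norm (h u))\<^sup>2 / 2 * K (u - t)) \<partial>lborel \<partial>lborel)"
  proof (rule nn_integral_mono)
    fix t
    have "ennreal (norm (cnj (h t) * (CLINT u|lborel. h u * of_real (K (u - t)))))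
      = ennreal (norm (CLINT u|lborel. cnj (h t) * (h u * of_real (K (u - t)))))"
      by simp
    also have "\<dots> \<le> (\<integral>\<^sup>+u. ennreal (norm (cnj (h t) * (h u * of_real (K (u - t))))) \<partial>lborel)"
      by (rule norm_int)
    also have "\<dots> \<le> (\<integral>\<^sup>+u. ennreal ((norm (h t))\<^sup>2 / 2 * K (u - t)) + ennreal ((norm (h u))\<^sup>2 / 2 * K (u - t)) \<partial>lborel)"
    proof (rule nn_integral_mono)
      fix u
      have "norm (h t) * norm (h u) \<le> (norm (h t))\<^sup>2 / 2 + (norm (h u))\<^sup>2 / 2"
        using sum_squares_bound[of "norm (h t)" "norm (h u)"] by simp
      then have "norm (h t) * norm (h u) * K (u - t) \<le> ((norm (h t))\<^sup>2 / 2 + (norm (h u))\<^sup>2 / 2) * K (u - t)"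
        using K0 by (rule mult_right_mono)
      then show "ennreal (norm (cnj (h t) * (h u * of_real (K (u - t)))))
        \<le> ennreal ((norm (h t))\<^sup>2 / 2 * K (u - t)) + ennreal ((norm (h u))\<^sup>2 / 2 * K (u - t))"
        using K0 by (subst ennreal_plus[symmetric]) (auto simp: norm_mult algebra_simps simp del: ennreal_plus intro!: ennreal_leI)
    qed
    finally show "ennreal (norm (cnj (h t) * (CLINT u|lborel. h u * of_real (K (u - t)))))
      \<le> (\<integral>\<^sup>+u. ennreal ((norm (h t))\<^sup>2 / 2 * K (u - t)) + ennreal ((norm (h u))\<^sup>2 / 2 * K (u - t)) \<partial>lborel)" .
  qed
  also have "\<dots> = (\<integral>\<^sup>+t. \<integral>\<^sup>+u. ennreal ((norm (h t))\<^sup>2 / 2 * K (u - t)) \<partial>lborel \<partial>lborel)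
      + (\<integral>\<^sup>+t. \<integral>\<^sup>+u. ennreal ((norm (h u))\<^sup>2 / 2 * K (u - t)) \<partial>lborel \<partial>lborel)"
    by (simp add: nn_integral_add)
  also have "(\<integral>\<^sup>+t. \<integral>\<^sup>+u. ennreal ((norm (h u))\<^sup>2 / 2 * K (u - t)) \<partial>lborel \<partial>lborel)
     = (\<integral>\<^sup>+t. \<integral>\<^sup>+u. ennreal ((norm (h t))\<^sup>2 / 2 * K (u - t)) \<partial>lborel \<partial>lborel)"
    by (subst lborel_pair.Fubini') (auto simp: Ksym)
  also have "(\<integral>\<^sup>+t. \<integral>\<^sup>+u. ennreal ((norm (h t))\<^sup>2 / 2 * K (u - t)) \<partial>lborel \<partial>lborel)
     = (\<integral>\<^sup>+t. ennreal ((norm (h t))\<^sup>2 / 2) \<partial>lborel)"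
    by (simp only: Kmult zero_le_divide_iff zero_le_power2 zero_le_numeral simp_thms)
  also have "(\<integral>\<^sup>+t. ennreal ((norm (h t))\<^sup>2 / 2) \<partial>lborel) + (\<integral>\<^sup>+t. ennreal ((norm (h t))\<^sup>2 / 2) \<partial>lborel)
     = (\<integral>\<^sup>+t. ennreal ((norm (h t))\<^sup>2) \<partial>lborel)"
    by (subst nn_integral_add[symmetric]) (auto simp: ennreal_plus[symmetric] simp del: ennreal_plus)
  finally show ?thesis by (simp add: \<phi>_def F_def)
qed

text \<open>As \<open>s\<close> tends to \<open>0\<close> the Gaussian factors tend to
  \<open>1\<close>, and Fatou's lemma preserves the uniform bound of
  \<open>gaussian_plancherel\<close>.\<close>

lemma plancherel_le:
  assumes h: "integrable lborel h"
  shows "(\<integral>\<^sup>+x. ennreal ((norm (fourier h x))\<^sup>2) \<partial>lborel) \<le> (\<integral>\<^sup>+t. ennreal ((norm (h t))\<^sup>2) \<partial>lborel)"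
proof -
  define G where "G n x = ennreal (exp (- (2 * pi * inverse (real (Suc n)) * x)\<^sup>2 / 2) * (norm (fourier h x))\<^sup>2)" for n x
  have [measurable]: "h \<in> borel_measurable borel" using h by auto
  have "(\<lambda>n. exp (- (2 * pi * inverse (real (Suc n)) * x)\<^sup>2 / 2) * (norm (fourier h x))\<^sup>2)
      \<longlonglongrightarrow> exp (- (2 * pi * 0 * x)\<^sup>2 / 2) * (norm (fourier h x))\<^sup>2" for x
    by (intro tendsto_intros LIMSEQ_inverse_real_of_nat) auto
  then have lim: "(\<lambda>n. G n x) \<longlonglongrightarrow> ennreal ((norm (fourier h x))\<^sup>2)" for x
    unfolding G_def by (intro tendsto_ennrealI) simp
  have "(\<integral>\<^sup>+x. ennreal ((norm (fourier h x))\<^sup>2) \<partial>lborel) = (\<integral>\<^sup>+x. liminf (\<lambda>n. G n x) \<partial>lborel)"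
    using lim_imp_Liminf[OF _ lim] by simp
  also have "\<dots> \<le> liminf (\<lambda>n. \<integral>\<^sup>+x. G n x \<partial>lborel)"
    unfolding G_def by (rule nn_integral_liminf) measurable
  also have "\<dots> \<le> liminf (\<lambda>n::nat. \<integral>\<^sup>+t. ennreal ((norm (h t))\<^sup>2) \<partial>lborel)"
    unfolding G_def using h by (intro Liminf_mono always_eventually allI gaussian_plancherel) auto
  finally show ?thesis by (simp add: Liminf_const)
qed

section \<open>The Hausdorff-Young inequality\<close>

lemma nn_integral_powr_from_0:
  fixes a c :: real
  assumes "a > -1" "c \<ge> 0"
  shows "(\<integral>\<^sup>+x. ennreal (indicator {0..c} x * x powr a) \<partial>lborel) = ennreal (c powr (a + 1) / (a + 1))"
  using nn_integral_has_integral_lebesgue[OF _ has_integral_powr_from_0[OF assms]] by simp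

lemma fourier_eq_0_AE:
  assumes "AE t in lborel. h t = 0"
  shows "fourier h x = 0"
  unfolding fourier_def using assms by (intro integral_eq_zero_AE) auto

text \<open>At each level \<open>l\<close> of the transform, \<open>h\<close> is split by size: the
  large part is controlled in \<open>L^1\<close>, the small part by Plancherel and Chebyshev, and
  the result is integrated over \<open>l\<close>. As \<open>N\<close> is the
  \<open>q / (q - 1)\<close>-th power of the norm of \<open>h\<close>, \<open>N powr (q - 1)\<close>
  is the \<open>q\<close>-th power of that norm.\<close>

theorem hausdorff_young_le:
  fixes h :: "real \<Rightarrow> complex" and q :: real
  defines "N \<equiv> (LINT t|lborel. norm (h t) powr (q / (q - 1)))"
  assumes q: "q > 2" and h: "integrable lborel h"
    and hq: "integrable lborel (\<lambda>t. norm (h t) powr (q / (q - 1)))"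
  shows "(\<integral>\<^sup>+x. ennreal (norm (fourier h x) powr q) \<partial>lborel)
    \<le> ennreal (2 powr q * q / (q - 2) * N powr (q - 1))"
proof (cases "N = 0")
  case True
  then have "AE t in lborel. norm (h t) powr (q / (q - 1)) = 0"
    unfolding N_def using hq by (subst (asm) integral_nonneg_eq_0_iff_AE) auto
  then have "AE t in lborel. h t = 0" by eventually_elim simp
  then show ?thesis using q by (simp add: fourier_eq_0_AE)
next
  case False
  moreover have "N \<ge> 0" unfolding N_def by simp
  ultimately have N: "N > 0" by simp
  define r where "r = q / (q - 1)"
  have r: "r > 1" using q by (simp add: r_def)
  have [measurable]: "h \<in> borel_measurable borel" using h by auto
  \<comment> \<open>The truncation height depends on the level \<open>l\<close> so that the cut-off part has
    \<open>L\<^sup>1\<close> norm at most \<open>l / 2\<close>.\<close>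
  define h2 where "h2 l t = (if l * norm (h t) powr (r - 1) \<le> 2 * N then h t else 0)" for l t
  have [measurable]: "(\<lambda>(l, t). h2 l t) \<in> borel_measurable (lborel \<Otimes>\<^sub>M lborel)"
    unfolding h2_def by measurable
  have [measurable]: "h2 l \<in> borel_measurable borel" for l
    unfolding h2_def by measurable
  have h2i: "integrable lborel (h2 l)" for l
    using h by (rule Bochner_Integration.integrable_bound) (auto simp: h2_def)
  \<comment> \<open>Where the transform of \<open>h\<close> reaches size \<open>l\<close>, the
    cut-off part supplies at most \<open>l / 2\<close>, so the truncated function
    \<open>h2 l\<close> must supply the rest.\<close>
  have key: "l / 2 \<le> norm (fourier (h2 l) x)" if l: "0 < l" "l \<le> norm (fourier h x)" for l x
  proof -
    have "fourier h x = fourier (h2 l) x + fourier (\<lambda>t. h t - h2 l t) x"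
      unfolding fourier_def left_diff_distrib
      by (subst Bochner_Integration.integral_diff, (intro integrable_mult_iexp h h2i)+, simp)
    moreover have "norm (fourier (\<lambda>t. h t - h2 l t) x) \<le> l / 2"
    proof -
      have "norm (fourier (\<lambda>t. h t - h2 l t) x) \<le> (LINT t|lborel. norm (h t - h2 l t))"
        by (rule norm_fourier_le)
      \<comment> \<open>Where \<open>h\<close> is cut off,
        \<open>l / (2 * N) * norm (h t) powr (r - 1)\<close> exceeds \<open>1\<close>.\<close>
      also have "\<dots> \<le> (LINT t|lborel. l / (2 * N) * norm (h t) powr r)"
      proof (rule integral_mono)
        fix t
        show "norm (h t - h2 l t) \<le> l / (2 * N) * norm (h t) powr r"
        proof (cases "l * norm (h t) powr (r - 1) \<le> 2 * N")
          case False
          then have "2 * N * norm (h t) \<le> l * norm (h t) powr (r - 1) * norm (h t)"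
            by (intro mult_right_mono) auto
          also have "norm (h t) powr (r - 1) * norm (h t) = norm (h t) powr r"
            using powr_mult_base[of "norm (h t)" "r - 1"] by (simp add: mult.commute)
          then have "l * norm (h t) powr (r - 1) * norm (h t) = l * norm (h t) powr r"
            by (simp add: mult.assoc)
          finally show ?thesis using N False by (simp add: h2_def field_simps)
        qed (use l N in \<open>simp add: h2_def\<close>)
      qed (use h h2i hq in \<open>auto simp: r_def\<close>)
      also have "\<dots> = l / 2"
        using N by (simp add: N_def r_def)
      finally show ?thesis .
    qed
    ultimately show ?thesis using l norm_triangle_ineq[of "fourier (h2 l) x" "fourier (\<lambda>t. h t - h2 l t) x"] by simp
  qed
  \<comment> \<open>\<open>D\<close> collects the factors free of \<open>norm (h t)\<close> that the
    integration over the levels \<open>l\<close> produces below.\<close>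
  define D where "D = 4 * q / (q - 2) * (2 * N) powr (q - 2)"
  \<comment> \<open>Layer cake formula: \<open>b powr q\<close> is the integral of
    \<open>q * l powr (q - 1)\<close> over \<open>{0..b}\<close>.\<close>
  have "(\<integral>\<^sup>+x. ennreal (norm (fourier h x) powr q) \<partial>lborel)
    = (\<integral>\<^sup>+x. \<integral>\<^sup>+l. ennreal (q * (indicator {0..norm (fourier h x)} l * l powr (q - 1))) \<partial>lborel \<partial>lborel)"
  proof (rule nn_integral_cong)
    fix x
    have "(\<integral>\<^sup>+l. ennreal (q * (indicator {0..norm (fourier h x)} l * l powr (q - 1))) \<partial>lborel)
      = ennreal q * (\<integral>\<^sup>+l. ennreal (indicator {0..norm (fourier h x)} l * l powr (q - 1)) \<partial>lborel)"
      using q by (simp add: ennreal_mult' nn_integral_cmult del: ennreal_indicator)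
    also have "\<dots> = ennreal (norm (fourier h x) powr q)"
      using q by (subst nn_integral_powr_from_0) (auto simp: ennreal_mult'[symmetric])
    finally show "ennreal (norm (fourier h x) powr q)
      = (\<integral>\<^sup>+l. ennreal (q * (indicator {0..norm (fourier h x)} l * l powr (q - 1))) \<partial>lborel)"
      by (rule sym)
  qed
  also have "\<dots> = (\<integral>\<^sup>+l. \<integral>\<^sup>+x. ennreal (q * (indicator {0..norm (fourier h x)} l * l powr (q - 1))) \<partial>lborel \<partial>lborel)"
    \<comment> \<open>As a conditional on \<open>l\<close> and \<open>x\<close>, the indicator of
      the interval depending on \<open>x\<close> becomes visibly jointly measurable.\<close>
    unfolding indicator_def atLeastAtMost_iff
    by (rule lborel_pair.Fubini'[symmetric]) measurable
  \<comment> \<open>Chebyshev's inequality at level \<open>l\<close>: by \<open>key\<close>,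
    squared, the factor \<open>4 * (norm (fourier (h2 l) x))\<^sup>2\<close> makes up for the loss
    of \<open>l\<^sup>2\<close>.\<close>
  also have "\<dots> \<le> (\<integral>\<^sup>+l. \<integral>\<^sup>+x. ennreal (4 * q * (indicator {0..} l * l powr (q - 3))) * ennreal ((norm (fourier (h2 l) x))\<^sup>2) \<partial>lborel \<partial>lborel)"
  proof (intro nn_integral_mono)
    fix l x
    have "l powr (q - 1) \<le> 4 * l powr (q - 3) * (norm (fourier (h2 l) x))\<^sup>2"
      if l: "0 < l" "l \<le> norm (fourier h x)"
    proof -
      have "l powr (q - 1) = l powr (q - 3) * l powr 2" by (simp add: powr_add[symmetric])
      also have "\<dots> = 4 * l powr (q - 3) * (l / 2)\<^sup>2" using l by (simp add: power2_eq_square)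
      also have "\<dots> \<le> 4 * l powr (q - 3) * (norm (fourier (h2 l) x))\<^sup>2"
        using key[OF l] l by (intro mult_left_mono power_mono) auto
      finally show ?thesis .
    qed
    \<comment> \<open>At \<open>l = 0\<close> both sides vanish, since \<open>0 powr x = 0\<close>
      for every \<open>x\<close>, also when \<open>q < 3\<close>.\<close>
    then have "q * (indicator {0..norm (fourier h x)} l * l powr (q - 1))
      \<le> q * (4 * (indicator {0..} l * l powr (q - 3)) * (norm (fourier (h2 l) x))\<^sup>2)"
      using q by (intro mult_left_mono) (cases "l = 0"; auto simp: indicator_def)+
    then show "ennreal (q * (indicator {0..norm (fourier h x)} l * l powr (q - 1)))
      \<le> ennreal (4 * q * (indicator {0..} l * l powr (q - 3))) * ennreal ((norm (fourier (h2 l) x))\<^sup>2)"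
      by (subst ennreal_mult''[symmetric]) (auto intro!: ennreal_leI simp: algebra_simps)
  qed
  also have "\<dots> \<le> (\<integral>\<^sup>+l. \<integral>\<^sup>+t. ennreal (4 * q * (indicator {0..} l * l powr (q - 3))) * ennreal ((norm (h2 l t))\<^sup>2) \<partial>lborel \<partial>lborel)"
    using plancherel_le[OF h2i] by - (rule nn_integral_mono, simp add: nn_integral_cmult mult_left_mono)
  also have "\<dots> = (\<integral>\<^sup>+t. \<integral>\<^sup>+l. ennreal (4 * q * (indicator {0..} l * l powr (q - 3))) * ennreal ((norm (h2 l t))\<^sup>2) \<partial>lborel \<partial>lborel)"
    by (rule lborel_pair.Fubini') measurable
  also have "\<dots> \<le> (\<integral>\<^sup>+t. ennreal (D * norm (h t) powr r) \<partial>lborel)"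
  proof (rule nn_integral_mono)
    fix t
    show "(\<integral>\<^sup>+l. ennreal (4 * q * (indicator {0..} l * l powr (q - 3))) * ennreal ((norm (h2 l t))\<^sup>2) \<partial>lborel)
      \<le> ennreal (D * norm (h t) powr r)"
    proof (cases "h t = 0")
      case True
      then show ?thesis by (simp add: h2_def)
    next
      case False
      define m where "m = norm (h t)"
      have m: "m > 0" using False by (simp add: m_def)
      \<comment> \<open>For fixed \<open>t\<close> the truncation condition reads
        \<open>l \<le> c\<close>. Since \<open>q - 3 > -1\<close>, \<open>l powr (q - 3)\<close> is
        integrable over \<open>{0..c}\<close>.\<close>
      define c where "c = 2 * N * m powr (1 - r)"
      have c: "c > 0" using N m by (simp add: c_def)
      have h2: "h2 l t = (if l \<le> c then h t else 0)" for l
      proof -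
        have "c = 2 * N / m powr (r - 1)" using powr_minus_divide[of m "r - 1"] by (simp add: c_def)
        then show ?thesis using m by (simp add: h2_def m_def[symmetric] pos_le_divide_eq)
      qed
      have "(\<integral>\<^sup>+l. ennreal (4 * q * (indicator {0..} l * l powr (q - 3))) * ennreal ((norm (h2 l t))\<^sup>2) \<partial>lborel)
        = (\<integral>\<^sup>+l. ennreal (4 * q * m\<^sup>2) * ennreal (indicator {0..c} l * l powr (q - 3)) \<partial>lborel)"
        using q by (intro nn_integral_cong)
          (auto simp: h2 m_def[symmetric] indicator_def ennreal_mult''[symmetric] mult_ac)
      also have "\<dots> = ennreal (4 * q * m\<^sup>2 * (c powr (q - 2) / (q - 2)))"
        using q c by (subst nn_integral_cmult)
          (auto simp: nn_integral_powr_from_0 ennreal_mult'[symmetric] simp del: ennreal_indicator)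
      also have "4 * q * m\<^sup>2 * (c powr (q - 2) / (q - 2)) = D * (m powr 2 * (m powr (1 - r)) powr (q - 2))"
        using m N by (simp add: c_def powr_mult D_def)
      also have "m powr 2 * (m powr (1 - r)) powr (q - 2) = m powr (2 + (1 - r) * (q - 2))"
        by (simp add: powr_powr powr_add)
      also have "2 + (1 - r) * (q - 2) = r" using q by (simp add: r_def field_simps)
      finally show ?thesis by (simp add: m_def)
    qed
  qed
  also have "\<dots> = ennreal (D * N)"
    using hq q N by (subst nn_integral_eq_integral) (auto simp: D_def N_def r_def)
  also have "D * N = 2 powr q * q / (q - 2) * N powr (q - 1)"
  proof -
    have "2 powr q = 2 powr 2 * 2 powr (q - 2)" by (subst powr_add[symmetric]) simp
    moreover have "N powr (q - 1) = N powr (q - 2) * N"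
      using powr_mult_base[of N "q - 2"] N by (simp add: mult.commute)
    ultimately show ?thesis using N by (simp add: D_def powr_mult)
  qed
  finally show ?thesis .
qed

section \<open>The weighted estimate\<close>

text \<open>Young's inequality with exponents \<open>r\<close> and \<open>r / (r - 1)\<close>;
  geometrically, the convex function \<open>u powr r\<close> lies above its tangent at
  \<open>m\<close>.\<close>

lemma powr_tangent_le:
  fixes u m r :: real
  assumes "r > 1" "u \<ge> 0" "m \<ge> 0"
  shows "r * m powr (r - 1) * u \<le> u powr r + (r - 1) * m powr r"
proof -
  have "u * m powr (r - 1) \<le> u powr r / r + (m powr (r - 1)) powr (r / (r - 1)) / (r / (r - 1))"
    using assms by (intro Youngs_inequality) (auto simp: field_simps)
  also have "(m powr (r - 1)) powr (r / (r - 1)) = m powr r"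
    using assms by (simp add: powr_powr)
  finally show ?thesis using assms by (simp add: field_simps)
qed

text \<open>The tangent inequality is integrated against \<open>w\<close>. The tangent at
  \<open>1\<close> gives integrability, the tangent at the weighted mean the bound. The mass of
  \<open>w\<close> is arbitrary, hence the factor with exponent \<open>r - 1\<close>.\<close>

lemma jensen_powr:
  fixes u w :: "'a \<Rightarrow> real"
  assumes r: "r > 1" and u0: "\<And>x. u x \<ge> 0" and w0: "\<And>x. w x \<ge> 0"
    and u[measurable]: "u \<in> borel_measurable M" and w: "integrable M w"
    and uw: "integrable M (\<lambda>x. u x powr r * w x)"
  shows "integrable M (\<lambda>x. u x * w x)"
    and "(LINT x|M. u x * w x) powr r \<le> (LINT x|M. w x) powr (r - 1) * (LINT x|M. u x powr r * w x)"
proof -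
  have [measurable]: "w \<in> borel_measurable M" using w by auto
  have le: "r * m powr (r - 1) * (u x * w x) \<le> u x powr r * w x + (r - 1) * m powr r * w x"
    if "m \<ge> 0" for m x
    using mult_right_mono[OF powr_tangent_le[OF r u0 that] w0[of x]] by (simp add: algebra_simps)
  show int: "integrable M (\<lambda>x. u x * w x)"
  proof (rule Bochner_Integration.integrable_bound)
    show "integrable M (\<lambda>x. u x powr r * w x + (r - 1) * w x)" using uw w by auto
    have "u x * w x \<le> u x powr r * w x + (r - 1) * w x" for x
      using le[of 1 x] mult_right_mono[of 1 r "u x * w x"] r u0 w0 by simp
    then show "AE x in M. norm (u x * w x) \<le> norm (u x powr r * w x + (r - 1) * w x)"
      using u0 w0 r by (intro AE_I2) auto
  qed measurable
  define W where "W = (LINT x|M. w x)"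
  have W0: "W \<ge> 0" using w0 by (simp add: W_def)
  show "(LINT x|M. u x * w x) powr r \<le> (LINT x|M. w x) powr (r - 1) * (LINT x|M. u x powr r * w x)"
  proof (cases "W = 0")
    case True
    then have "AE x in M. w x = 0"
      unfolding W_def using w w0 by (subst (asm) integral_nonneg_eq_0_iff_AE) auto
    then have "(LINT x|M. u x * w x) = 0" by (intro integral_eq_zero_AE) auto
    then show ?thesis using True by (simp add: W_def)
  next
    case False
    define m where "m = (LINT x|M. u x * w x) / W"
    have eq: "(LINT x|M. u x * w x) = m * W" using False by (simp add: m_def)
    have m0: "m \<ge> 0" unfolding m_def using W0 u0 w0 by (auto intro!: integral_nonneg divide_nonneg_nonneg)
    have "(LINT x|M. r * m powr (r - 1) * (u x * w x)) \<le> (LINT x|M. u x powr r * w x + (r - 1) * m powr r * w x)"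
      by (rule integral_mono) (use int uw w le[OF m0] in auto)
    also have "\<dots> = (LINT x|M. u x powr r * w x) + (r - 1) * m powr r * W"
      using uw w by (simp add: W_def)
    also have "(LINT x|M. r * m powr (r - 1) * (u x * w x)) = r * (m powr (r - 1) * m) * W"
      by (simp add: eq)
    also have "m powr (r - 1) * m = m powr r"
      using powr_mult_base[of m "r - 1"] m0 by (simp add: mult.commute)
    finally have "m powr r * W \<le> (LINT x|M. u x powr r * w x)" by (simp add: algebra_simps)
    then have "W powr (r - 1) * (m powr r * W) \<le> W powr (r - 1) * (LINT x|M. u x powr r * w x)"
      by (rule mult_left_mono) simp
    moreover have "W powr (r - 1) * (m powr r * W) = (m * W) powr r"
      using powr_mult_base[of W "r - 1"] W0 m0 by (simp add: powr_mult mult_ac)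
    ultimately show ?thesis by (simp add: eq W_def[symmetric])
  qed
qed

section \<open>Gamma integrals\<close>

text \<open>The substitution \<open>t = x / b\<close> reduces this to Euler's integral. It provides
  the masses of the weights for Jensen's inequality and the final integral over
  \<open>y\<close>.\<close>

lemma nn_integral_Gamma_scaled:
  fixes k b :: real
  assumes k: "k > 0" and b: "b > 0"
  shows "(\<integral>\<^sup>+t. ennreal (indicator {0..} t * (t powr (k - 1) * exp (- (b * t)))) \<partial>lborel)
    = ennreal (Gamma k / b powr k)"
proof -
  have "(\<integral>\<^sup>+t. ennreal (indicator {0..} t * (t powr (k - 1) * exp (- (b * t)))) \<partial>lborel)
    = ennreal \<bar>1 / b\<bar> * (\<integral>\<^sup>+x. ennreal (indicator {0..} (0 + 1 / b * x) * ((0 + 1 / b * x) powr (k - 1) * exp (- (b * (0 + 1 / b * x))))) \<partial>lborel)"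
    using b by (intro nn_integral_real_affine) auto
  also have "(\<integral>\<^sup>+x. ennreal (indicator {0..} (0 + 1 / b * x) * ((0 + 1 / b * x) powr (k - 1) * exp (- (b * (0 + 1 / b * x))))) \<partial>lborel)
    = (\<integral>\<^sup>+x. ennreal ((1 / b) powr (k - 1)) * ennreal (indicator {0..} x * (x powr (k - 1) / exp x)) \<partial>lborel)"
    using b by (intro nn_integral_cong)
      (auto simp: indicator_def zero_le_divide_iff powr_divide exp_minus field_simps ennreal_mult''[symmetric])
  also have "\<dots> = ennreal ((1 / b) powr (k - 1)) * ennreal (Gamma k)"
    using nn_integral_has_integral_lebesgue[OF _ Gamma_integral_real[OF k]]
    by (simp add: nn_integral_cmult del: ennreal_indicator)
  also have "ennreal \<bar>1 / b\<bar> * (ennreal ((1 / b) powr (k - 1)) * ennreal (Gamma k))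
    = ennreal ((1 / b * (1 / b) powr (k - 1)) * Gamma k)"
    using b k by (simp add: ennreal_mult'[symmetric] mult.assoc Gamma_real_pos less_imp_le)
  also have "1 / b * (1 / b) powr (k - 1) = 1 / b powr k"
    using b powr_mult_base[of "1 / b" "k - 1"] by (simp add: powr_divide)
  finally show ?thesis by simp
qed

lemma has_bochner_integral_Gamma_scaled:
  fixes k b :: real
  assumes "k > 0" "b > 0"
  shows "has_bochner_integral lborel (\<lambda>t. indicator {0..} t * (t powr (k - 1) * exp (- (b * t)))) (Gamma k / b powr k)"
  by (rule has_bochner_integral_nn_integral)
    (use assms nn_integral_Gamma_scaled[OF assms] in \<open>auto simp: Gamma_real_pos less_imp_le\<close>)

text \<open>Raise \<open>b * t / k \<le> exp (b * t / k)\<close> to the power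
  \<open>k\<close>.\<close>

lemma powr_mult_exp_le:
  fixes k b t :: real
  assumes k: "k > 0" and b: "b > 0" and t: "t > 0"
  shows "t powr k * exp (- (b * t)) \<le> (k / b) powr k"
proof -
  have "b * t / k \<le> exp (b * t / k)" using exp_ge_add_one_self[of "b * t / k"] by linarith
  then have "(b * t / k) powr k \<le> exp (b * t / k) powr k"
    using k b t by (intro powr_mono2) auto
  also have "exp (b * t / k) powr k = exp (b * t)" using k by (simp add: powr_def)
  finally have "(k / b) powr k * (b * t / k) powr k \<le> (k / b) powr k * exp (b * t)"
    by (rule mult_left_mono) simp
  moreover have "(k / b) powr k * (b * t / k) powr k = t powr k"
    using k b t by (subst powr_mult[symmetric]) auto
  ultimately show ?thesis by (simp add: exp_minus field_simps)
qed

section \<open>The estimate for exponentially damped functions\<close>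

text \<open>With \<open>q' = q / (q - 1)\<close>, \<open>r\<close> is \<open>p / q'\<close>, the
  Jensen exponent that turns \<open>norm (g t) powr q'\<close> into
  \<open>norm (g t) powr p\<close>, and \<open>a\<close> is chosen so that the damping factor to the
  power \<open>q'\<close> is \<open>exp (- (a * y * t))\<close>. The power \<open>k\<close> of
  \<open>t\<close> is what the weight \<open>t powr (- 1 / 2)\<close> leaves over.\<close>

context
  fixes p q :: real and g :: "real \<Rightarrow> complex" and r k a A :: real
  assumes p: "2 < p" and pq: "p \<le> q"
    and g[measurable]: "g \<in> borel_measurable borel"
    and g0: "\<And>t. t \<le> 0 \<Longrightarrow> g t = 0"
    and gp: "integrable lborel (\<lambda>t. norm (g t) powr p)"
  defines "r \<equiv> p * (q - 1) / q" and "k \<equiv> (r - 1) / 2" and "a \<equiv> 2 * pi * (q / (q - 1))"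
    and "A \<equiv> (LINT t|lborel. norm (g t) powr p)"
begin

text \<open>The assumption \<open>2 < p\<close> enters through \<open>r > 1\<close>:
  \<open>p * (q - 1) > 2 * (q - 1) > q\<close>.\<close>

lemma exponent_facts: "q > 2" "r > 1" "k > 0" "a > 0" "A \<ge> 0" "q / (q - 1) * r = p" "(q - 1) / r = q / p"
proof -
  show q: "q > 2" using p pq by simp
  have "2 * (q - 1) < p * (q - 1)" using p q by (intro mult_strict_right_mono) auto
  then have "p * (q - 1) > q" using q by simp
  then show r: "r > 1" using q by (simp add: r_def)
  show "k > 0" using r by (simp add: k_def)
  show "a > 0" using q by (simp add: a_def)
  show "A \<ge> 0" by (simp add: A_def)
  show "q / (q - 1) * r = p" "(q - 1) / r = q / p" using q p by (auto simp: r_def)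
qed

text \<open>The Hausdorff-Young bound requires an integrable function. Jensen's inequality with
  exponent \<open>p\<close> applies, because the exponential weight has finite mass and is at most
  \<open>1\<close> on the half-line.\<close>

lemma integrable_damped:
  assumes y: "y > 0"
  shows "integrable lborel (\<lambda>t. g t * of_real (exp (- (2 * pi * y * t))))"
proof -
  \<comment> \<open>The factor \<open>t powr (1 - 1)\<close> gives \<open>w\<close> the shape of a
    Gamma integrand. It is \<open>0\<close> at \<open>t = 0\<close>, where \<open>g\<close> vanishes
    too.\<close>
  define w where "w t = indicator {0..} t * (t powr (1 - 1) * exp (- (2 * pi * y * t)))" for t :: real
  have w0: "w t \<ge> 0" and w1: "w t \<le> 1" for t using y by (auto simp: w_def indicator_def)
  have [measurable]: "w \<in> borel_measurable borel" unfolding w_def by measurable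
  have "integrable lborel w"
    unfolding w_def using y has_bochner_integral_Gamma_scaled[of 1 "2 * pi * y"]
    by (auto simp: has_bochner_integral_iff)
  moreover have "integrable lborel (\<lambda>t. norm (g t) powr p * w t)"
  proof (rule Bochner_Integration.integrable_bound[OF gp])
    have "norm (norm (g t) powr p * w t) \<le> norm (norm (g t) powr p)" for t
      using w0[of t] w1[of t] by (simp add: abs_mult mult_right_le_one_le)
    then show "AE t in lborel. norm (norm (g t) powr p * w t) \<le> norm (norm (g t) powr p)"
      by simp
  qed measurable
  ultimately have "integrable lborel (\<lambda>t. norm (g t) * w t)"
    using p by (intro jensen_powr(1)[where r = p and u = "\<lambda>t. norm (g t)"] w0; simp)
  then show ?thesis
  proof (rule Bochner_Integration.integrable_bound)
    have "norm (g t * of_real (exp (- (2 * pi * y * t)))) \<le> norm (norm (g t) * w t)" for t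
      by (cases "t \<le> 0") (simp_all add: g0 norm_mult w_def)
    then show "AE t in lborel. norm (g t * of_real (exp (- (2 * pi * y * t)))) \<le> norm (norm (g t) * w t)"
      by simp
  qed measurable
qed

text \<open>This is the integral on the right of Jensen's inequality. Integrated against
  \<open>y powr (k - 1)\<close> it becomes a multiple of \<open>A\<close>.\<close>

private definition J :: "real \<Rightarrow> real" where
  "J y = (LINT t|lborel. norm (g t) powr p * (t powr k * exp (- (a * y * t))))"

text \<open>The kernel is at most \<open>(k / (a * y)) powr k\<close>. The resulting bound on
  \<open>J\<close> absorbs its surplus power when \<open>q\<close> exceeds \<open>p\<close>.\<close>

lemma J_integrable_bound:
  assumes y: "y > 0"
  shows "integrable lborel (\<lambda>t. norm (g t) powr p * (t powr k * exp (- (a * y * t))))"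
    and "J y \<le> (k / a) powr k * y powr (- k) * A" and "J y \<ge> 0"
proof -
  have ay: "a * y > 0" using exponent_facts y by simp
  have le: "norm (g t) powr p * (t powr k * exp (- (a * y * t))) \<le> (k / (a * y)) powr k * norm (g t) powr p" for t
    using g0[of t] powr_mult_exp_le[OF exponent_facts(3) ay, of t] p
    by (cases "t \<le> 0") (auto simp: mult.commute intro: mult_left_mono)
  show int: "integrable lborel (\<lambda>t. norm (g t) powr p * (t powr k * exp (- (a * y * t))))"
  proof (rule Bochner_Integration.integrable_bound)
    show "integrable lborel (\<lambda>t. (k / (a * y)) powr k * norm (g t) powr p)" using gp by simp
    show "AE t in lborel. norm (norm (g t) powr p * (t powr k * exp (- (a * y * t))))
      \<le> norm ((k / (a * y)) powr k * norm (g t) powr p)"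
      using le by (intro AE_I2) simp
  qed measurable
  have "J y \<le> (LINT t|lborel. (k / (a * y)) powr k * norm (g t) powr p)"
    unfolding J_def by (rule integral_mono) (use int gp le in auto)
  also have "\<dots> = (k / (a * y)) powr k * A" by (simp add: A_def)
  also have "(k / (a * y)) powr k = (k / a) powr k * y powr (- k)"
    using exponent_facts y by (simp add: powr_divide powr_mult powr_minus_divide)
  finally show "J y \<le> (k / a) powr k * y powr (- k) * A" .
  show "J y \<ge> 0" unfolding J_def by simp
qed

text \<open>The quantity \<open>N\<close> of \<open>hausdorff_young_le\<close> for the damped
  function.\<close>

private definition N :: "real \<Rightarrow> real" where
  "N y = (LINT t|lborel. norm (g t * of_real (exp (- (2 * pi * y * t)))) powr (q / (q - 1)))"

private definition c1 :: real where
  "c1 = (Gamma (1 / 2) / a powr (1 / 2)) powr ((r - 1) * (q / p)) * ((k / a) powr k) powr (q / p - 1)"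

text \<open>Jensen's inequality for \<open>u\<close> and \<open>w\<close> bounds
  \<open>N y powr r\<close> by \<open>J y\<close> times a power of \<open>y\<close>; the power
  \<open>q / p\<close> of this is what Hausdorff-Young calls for, as
  \<open>r * (q / p) = q - 1\<close>.\<close>

lemma N_integrable_bound:
  assumes y: "y > 0"
  shows "integrable lborel (\<lambda>t. norm (g t * of_real (exp (- (2 * pi * y * t)))) powr (q / (q - 1)))"
    and "N y powr (q - 1) * y powr (q - q / p - 2) \<le> c1 * A powr (q / p - 1) * y powr (k - 1) * J y"
proof -
  have ay: "a * y > 0" using exponent_facts y by simp
  \<comment> \<open>The factors \<open>t powr (1 / 2)\<close> in \<open>u\<close> and
    \<open>t powr (- 1 / 2)\<close> in \<open>w\<close> cancel in the product but leave
    \<open>t powr k\<close> in \<open>u t powr r * w t\<close>. Having \<open>k > 0\<close> makes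
    \<open>y powr (k - 1)\<close> integrable near \<open>0\<close>.\<close>
  define w where "w t = indicator {0..} t * (t powr (1 / 2 - 1) * exp (- (a * y * t)))" for t :: real
  define u where "u t = norm (g t) powr (q / (q - 1)) * t powr (1 / 2)" for t
  have w: "has_bochner_integral lborel w (Gamma (1 / 2) / (a * y) powr (1 / 2))"
    unfolding w_def using ay by (intro has_bochner_integral_Gamma_scaled) auto
  have uw: "u t * w t = norm (g t * of_real (exp (- (2 * pi * y * t)))) powr (q / (q - 1))" for t
  proof (cases "t \<le> 0")
    case False
    then have "t powr (1 / 2) * t powr (1 / 2 - 1) = 1" by (simp add: powr_add[symmetric])
    moreover have "exp (- (2 * pi * y * t)) powr (q / (q - 1)) = exp (- (a * y * t))"
      by (simp add: powr_def a_def mult_ac)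
    ultimately show ?thesis using False
      by (simp add: u_def w_def norm_mult powr_mult)
  qed (use g0[of t] exponent_facts in \<open>auto simp: u_def\<close>)
  have urw: "u t powr r * w t = norm (g t) powr p * (t powr k * exp (- (a * y * t)))" for t
  proof (cases "t \<le> 0")
    case False
    then have "t powr (r / 2) * t powr (1 / 2 - 1) = t powr k"
      by (simp add: powr_add[symmetric] k_def field_simps)
    then show ?thesis using False exponent_facts(6)
      by (simp add: u_def w_def powr_mult powr_powr mult_ac)
  qed (use g0[of t] p in \<open>auto simp: u_def\<close>)
  have [measurable]: "u \<in> borel_measurable borel" unfolding u_def by measurable
  have int: "integrable lborel (\<lambda>t. u t powr r * w t)"
    unfolding urw by (rule J_integrable_bound(1)[OF y])
  have wi: "integrable lborel w" and wI: "(LINT t|lborel. w t) = Gamma (1 / 2) / (a * y) powr (1 / 2)"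
    using w by (auto simp: has_bochner_integral_iff)
  have nn: "u t \<ge> 0" "w t \<ge> 0" for t by (auto simp: u_def w_def)
  note jen = jensen_powr[of r u w lborel, OF exponent_facts(2) nn _ wi int]
  show "integrable lborel (\<lambda>t. norm (g t * of_real (exp (- (2 * pi * y * t)))) powr (q / (q - 1)))"
    using jen(1) by (simp add: uw)
  have "N y powr r \<le> (Gamma (1 / 2) / (a * y) powr (1 / 2)) powr (r - 1) * J y"
    using jen(2) unfolding uw urw wI N_def J_def by simp
  then have "(N y powr r) powr (q / p) \<le> ((Gamma (1 / 2) / (a * y) powr (1 / 2)) powr (r - 1) * J y) powr (q / p)"
    using p pq by (intro powr_mono2) auto
  moreover have "(N y powr r) powr (q / p) = N y powr (q - 1)"
    using exponent_facts by (simp add: powr_powr flip: exponent_facts(7))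
  moreover have "((Gamma (1 / 2) / (a * y) powr (1 / 2)) powr (r - 1) * J y) powr (q / p)
    = (Gamma (1 / 2) / a powr (1 / 2)) powr ((r - 1) * (q / p)) * y powr (- k * (q / p)) * J y powr (q / p)"
  proof -
    have "Gamma (1 / 2) / (a * y) powr (1 / 2) = Gamma (1 / 2) / a powr (1 / 2) * y powr (- (1 / 2))"
      using exponent_facts y by (simp add: powr_mult powr_minus field_simps)
    moreover have "- (1 / 2) * (r - 1) * (q / p) = - k * (q / p)"
      by (simp add: k_def)
    moreover have "Gamma (1 / 2) / a powr (1 / 2) \<ge> 0" by (simp add: Gamma_real_pos less_imp_le)
    ultimately show ?thesis using J_integrable_bound(3)[OF y]
      by (simp only: powr_mult powr_powr mult_nonneg_nonneg powr_ge_zero)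
  qed
  \<comment> \<open>One factor \<open>J y\<close> is kept for the integration over \<open>y\<close>;
    the remaining power \<open>q / p - 1 \<ge> 0\<close> is estimated uniformly.\<close>
  moreover have "J y powr (q / p) \<le> J y * (((k / a) powr k) powr (q / p - 1) * y powr (- k * (q / p - 1)) * A powr (q / p - 1))"
  proof -
    have "J y powr (q / p) = J y * J y powr (q / p - 1)"
      using powr_mult_base[of "J y" "q / p - 1"] J_integrable_bound(3)[OF y] by simp
    also have "\<dots> \<le> J y * ((k / a) powr k * y powr (- k) * A) powr (q / p - 1)"
      using J_integrable_bound[OF y] p pq by (intro mult_left_mono powr_mono2) auto
    finally show ?thesis using exponent_facts by (simp add: powr_mult powr_powr)
  qed
  ultimately have "N y powr (q - 1) \<le> (Gamma (1 / 2) / a powr (1 / 2)) powr ((r - 1) * (q / p)) * y powr (- k * (q / p))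
     * (J y * (((k / a) powr k) powr (q / p - 1) * y powr (- k * (q / p - 1)) * A powr (q / p - 1)))"
    by (smt (verit, best) mult_left_mono mult_nonneg_nonneg powr_ge_zero)
  then have "N y powr (q - 1) * y powr (q - q / p - 2) \<le> (Gamma (1 / 2) / a powr (1 / 2)) powr ((r - 1) * (q / p)) * y powr (- k * (q / p))
     * (J y * (((k / a) powr k) powr (q / p - 1) * y powr (- k * (q / p - 1)) * A powr (q / p - 1))) * y powr (q - q / p - 2)"
    by (rule mult_right_mono) simp
  also have "\<dots> = c1 * A powr (q / p - 1) * (y powr (- k * (q / p)) * y powr (- k * (q / p - 1)) * y powr (q - q / p - 2)) * J y"
    by (simp add: c1_def mult_ac)
  also have "y powr (- k * (q / p)) * y powr (- k * (q / p - 1)) * y powr (q - q / p - 2)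
    = y powr (- k * (q / p) + - k * (q / p - 1) + (q - q / p - 2))"
    by (simp only: powr_add)
  \<comment> \<open>The exponents match because
    \<open>2 * k * (q / p) = (r - 1) * (q / p) = q - 1 - q / p\<close>.\<close>
  also have "- k * (q / p) + - k * (q / p - 1) + (q - q / p - 2) = k - 1"
  proof -
    have "r * (q / p) = q - 1" using exponent_facts(2,7) by (simp add: field_simps)
    moreover have "2 * k = r - 1" by (simp add: k_def)
    ultimately have "2 * k * (q / p) = q - 1 - q / p"
      by (simp only: left_diff_distrib mult_1_left)
    then show ?thesis by (simp add: right_diff_distrib del: times_divide_eq_right)
  qed
  finally show "N y powr (q - 1) * y powr (q - q / p - 2) \<le> c1 * A powr (q / p - 1) * y powr (k - 1) * J y" .
qed

text \<open>Hausdorff-Young on each horizontal line reduces the claim to the integral of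
  \<open>y powr (k - 1) * J y\<close>. By Tonelli the integral over \<open>y\<close> comes first;
  its value \<open>Gamma k / (a * t) powr k\<close> cancels \<open>t powr k\<close>, and
  \<open>A powr (q / p - 1) * A\<close> remains.\<close>

lemma damped_fourier_bound:
  "(\<integral>\<^sup>+y\<in>{0<..}. (\<integral>\<^sup>+x. ennreal (norm (fourier (\<lambda>t. g t * of_real (exp (- (2 * pi * y * t)))) x) powr q
      * y powr (q - q / p - 2)) \<partial>lborel) \<partial>lborel)
    \<le> ennreal (2 powr q * q / (q - 2) * c1 * Gamma k / a powr k * A powr (q / p))"
proof -
  note ef = exponent_facts
  define c2 where "c2 = 2 powr q * q / (q - 2)"
  define c where "c = c2 * c1 * A powr (q / p - 1)"
  have c2: "c2 \<ge> 0" using ef by (simp add: c2_def)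
  have c0: "c \<ge> 0" using c2 by (simp add: c_def c1_def)
  have "(\<integral>\<^sup>+y\<in>{0<..}. (\<integral>\<^sup>+x. ennreal (norm (fourier (\<lambda>t. g t * of_real (exp (- (2 * pi * y * t)))) x) powr q
      * y powr (q - q / p - 2)) \<partial>lborel) \<partial>lborel)
    \<le> (\<integral>\<^sup>+y. \<integral>\<^sup>+t. ennreal (c * (indicator {0..} y * y powr (k - 1))) *
       ennreal (norm (g t) powr p * (t powr k * exp (- (a * y * t)))) \<partial>lborel \<partial>lborel)"
  proof (rule nn_integral_mono)
    fix y :: real
    show "(\<integral>\<^sup>+x. ennreal (norm (fourier (\<lambda>t. g t * of_real (exp (- (2 * pi * y * t)))) x) powr q
        * y powr (q - q / p - 2)) \<partial>lborel) * indicator {0<..} y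
      \<le> (\<integral>\<^sup>+t. ennreal (c * (indicator {0..} y * y powr (k - 1))) *
       ennreal (norm (g t) powr p * (t powr k * exp (- (a * y * t)))) \<partial>lborel)"
    proof (cases "y > 0")
      case True
      have "(\<integral>\<^sup>+x. ennreal (norm (fourier (\<lambda>t. g t * of_real (exp (- (2 * pi * y * t)))) x) powr q
          * y powr (q - q / p - 2)) \<partial>lborel)
        = (\<integral>\<^sup>+x. ennreal (norm (fourier (\<lambda>t. g t * of_real (exp (- (2 * pi * y * t)))) x) powr q) \<partial>lborel)
          * ennreal (y powr (q - q / p - 2))"
        by (simp add: ennreal_mult nn_integral_multc)
      also have "\<dots> \<le> ennreal (c2 * N y powr (q - 1)) * ennreal (y powr (q - q / p - 2))"
        using hausdorff_young_le[OF ef(1) integrable_damped[OF True] N_integrable_bound(1)[OF True]]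
        by (intro mult_right_mono) (auto simp: c2_def N_def)
      also have "\<dots> = ennreal (c2 * (N y powr (q - 1) * y powr (q - q / p - 2)))"
        using c2 by (simp add: ennreal_mult[symmetric] mult.assoc)
      also have "\<dots> \<le> ennreal (c2 * (c1 * A powr (q / p - 1) * y powr (k - 1) * J y))"
        using N_integrable_bound(2)[OF True] c2 by (intro ennreal_leI mult_left_mono)
      also have "\<dots> = ennreal (c * y powr (k - 1)) * ennreal (J y)"
      proof -
        have "c2 * (c1 * A powr (q / p - 1) * y powr (k - 1) * J y) = c * y powr (k - 1) * J y"
          by (simp add: c_def)
        then show ?thesis using c0 J_integrable_bound(3)[OF True] by (simp only: ennreal_mult mult_nonneg_nonneg powr_ge_zero)
      qed
      also have "ennreal (J y) = (\<integral>\<^sup>+t. ennreal (norm (g t) powr p * (t powr k * exp (- (a * y * t)))) \<partial>lborel)"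
        unfolding J_def using J_integrable_bound(1)[OF True]
        by (intro nn_integral_eq_integral[symmetric]) auto
      finally show ?thesis using True by (simp add: nn_integral_cmult)
    qed simp
  qed
  also have "\<dots> = (\<integral>\<^sup>+t. \<integral>\<^sup>+y. ennreal (c * (indicator {0..} y * y powr (k - 1))) *
       ennreal (norm (g t) powr p * (t powr k * exp (- (a * y * t)))) \<partial>lborel \<partial>lborel)"
    by (rule lborel_pair.Fubini'[symmetric]) measurable
  also have "\<dots> = (\<integral>\<^sup>+t. ennreal (c * Gamma k / a powr k) * ennreal (norm (g t) powr p) \<partial>lborel)"
  proof (rule nn_integral_cong)
    fix t :: real
    show "(\<integral>\<^sup>+y. ennreal (c * (indicator {0..} y * y powr (k - 1))) *
       ennreal (norm (g t) powr p * (t powr k * exp (- (a * y * t)))) \<partial>lborel)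
      = ennreal (c * Gamma k / a powr k) * ennreal (norm (g t) powr p)"
    proof (cases "t \<le> 0")
      case False
      have "(\<integral>\<^sup>+y. ennreal (c * (indicator {0..} y * y powr (k - 1))) *
         ennreal (norm (g t) powr p * (t powr k * exp (- (a * y * t)))) \<partial>lborel)
        = (\<integral>\<^sup>+y. ennreal (c * norm (g t) powr p * t powr k) *
            ennreal (indicator {0..} y * (y powr (k - 1) * exp (- (a * t * y)))) \<partial>lborel)"
        using c0 by (intro nn_integral_cong) (auto simp: ennreal_mult[symmetric] mult_ac)
      also have "\<dots> = ennreal (c * norm (g t) powr p * t powr k) * ennreal (Gamma k / (a * t) powr k)"
        using ef False by (simp add: nn_integral_cmult nn_integral_Gamma_scaled del: ennreal_indicator)
      also have "\<dots> = ennreal (c * Gamma k / a powr k) * ennreal (norm (g t) powr p)"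
        using ef False c0
        by (auto simp: ennreal_mult[symmetric] powr_mult Gamma_real_pos less_imp_le)
      finally show ?thesis .
    qed (use g0[of t] p in simp)
  qed
  also have "\<dots> = ennreal (c * Gamma k / a powr k) * ennreal A"
    using gp by (simp add: nn_integral_cmult nn_integral_eq_integral A_def)
  also have "\<dots> = ennreal (c * Gamma k / a powr k * A)"
    using ef(5) by (rule ennreal_mult''[symmetric])
  also have "c * Gamma k / a powr k * A = c2 * c1 * Gamma k / a powr k * A powr (q / p)"
    using powr_mult_base[of A "q / p - 1"] ef by (simp add: c_def field_simps)
  finally show ?thesis by (simp add: c2_def)
qed

end

section \<open>Laplace transforms\<close>

text \<open>The Fubini arguments above concern Borel functions, whereas \<open>f\<close> is only
  Lebesgue measurable on the half-line. Its extension by \<open>0\<close> is modified on a null set,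
  separately in real and imaginary part.\<close>

lemma borel_representative:
  fixes f :: "real \<Rightarrow> complex"
  assumes f: "f \<in> borel_measurable lebesgue_pos"
  obtains g where "g \<in> borel_measurable borel" "\<And>t. t \<le> 0 \<Longrightarrow> g t = 0"
    "AE t in lborel. t > 0 \<longrightarrow> g t = f t"
proof -
  define F where "F t = indicator {0<..} t *\<^sub>R f t" for t :: real
  have F: "F \<in> borel_measurable lebesgue"
    using f unfolding F_def by (subst (asm) borel_measurable_restrict_space_iff) auto
  have "(\<lambda>t. Re (F t)) \<in> borel_measurable lebesgue"
    using F by simp
  from completion_ex_borel_measurable_real[OF this]
  obtain u where [measurable]: "u \<in> borel_measurable lborel" and u: "AE t in lborel. Re (F t) = u t"
    by blast
  have "(\<lambda>t. Im (F t)) \<in> borel_measurable lebesgue"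
    using F by simp
  from completion_ex_borel_measurable_real[OF this]
  obtain v where [measurable]: "v \<in> borel_measurable lborel" and v: "AE t in lborel. Im (F t) = v t"
    by blast
  define g where "g t = (if t > 0 then of_real (u t) + \<i> * of_real (v t) else 0)" for t
  have "g \<in> borel_measurable borel" unfolding g_def by measurable
  moreover have "AE t in lborel. t > 0 \<longrightarrow> g t = f t"
    using u v by eventually_elim (auto simp: g_def F_def complex_eq_iff)
  ultimately show ?thesis using that by (simp add: g_def)
qed

text \<open>The map \<open>H\<close> allows one statement for both the \<open>p\<close>-th power of
  the norm and the Laplace integrand. The condition \<open>H t 0 = 0\<close> makes the integrand
  vanish on the negative half-line.\<close>

lemma lebesgue_pos_transfer:
  fixes H :: "real \<Rightarrow> complex \<Rightarrow> 'b::{banach, second_countable_topology}"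
  assumes eq: "AE t in lborel. t > 0 \<longrightarrow> g t = f t" and g0: "\<And>t. t \<le> 0 \<Longrightarrow> g t = 0"
    and H0: "\<And>t. H t 0 = 0"
    and f: "(\<lambda>t. H t (f t)) \<in> borel_measurable lebesgue_pos"
    and g: "(\<lambda>t. H t (g t)) \<in> borel_measurable borel"
  shows "integrable lborel (\<lambda>t. H t (g t)) \<longleftrightarrow> integrable lebesgue_pos (\<lambda>t. H t (f t))"
    and "(LINT t|lborel. H t (g t)) = (LINT t|lebesgue_pos. H t (f t))"
proof -
  have f': "(\<lambda>t. indicator {0<..} t *\<^sub>R H t (f t)) \<in> borel_measurable lebesgue"
    using f by (subst (asm) borel_measurable_restrict_space_iff) auto
  have g': "(\<lambda>t. H t (g t)) \<in> borel_measurable lebesgue"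
    using g by (simp add: measurable_completion)
  have ae: "AE t in lebesgue. H t (g t) = indicator {0<..} t *\<^sub>R H t (f t)"
    using AE_completion[OF eq] by eventually_elim (auto simp: indicator_def g0 H0)
  have "integrable lborel (\<lambda>t. H t (g t)) \<longleftrightarrow> integrable lebesgue (\<lambda>t. H t (g t))"
    using g by (intro integrable_completion[symmetric]) simp
  also have "\<dots> \<longleftrightarrow> integrable lebesgue (\<lambda>t. indicator {0<..} t *\<^sub>R H t (f t))"
    by (rule integrable_cong_AE[OF g' f' ae])
  also have "\<dots> \<longleftrightarrow> integrable lebesgue_pos (\<lambda>t. H t (f t))"
    by (rule integrable_restrict_space[symmetric]) simp
  finally show "integrable lborel (\<lambda>t. H t (g t)) \<longleftrightarrow> integrable lebesgue_pos (\<lambda>t. H t (f t))" .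
  have "(LINT t|lborel. H t (g t)) = (LINT t|lebesgue. H t (g t))"
    using g by (intro integral_completion[symmetric]) simp
  also have "\<dots> = (LINT t|lebesgue. indicator {0<..} t *\<^sub>R H t (f t))"
    by (rule integral_cong_AE[OF g' f' ae])
  also have "\<dots> = (LINT t|lebesgue_pos. H t (f t))"
    by (rule integral_restrict_space[symmetric]) simp
  finally show "(LINT t|lborel. H t (g t)) = (LINT t|lebesgue_pos. H t (f t))" .
qed

section \<open>Holomorphy of the Laplace transform\<close>

text \<open>Taylor's estimate costs half of the decay \<open>exp (- (2 * pi * t * y))\<close>, with
  \<open>y = Im z\<close>, and absorbing the factor \<open>t\<close> costs another quarter. What
  remains is the Laplace kernel at height \<open>y / 4\<close>, a majorant independent of
  \<open>h\<close>.\<close>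

lemma difference_quotient_exp_bound:
  fixes z h :: complex and t :: real
  assumes t: "t > 0" and z: "Im z > 0" and h: "norm h < Im z / 2" "h \<noteq> 0"
  shows "norm (exp (2 * of_real pi * \<i> * of_real t * z) * ((exp (2 * of_real pi * \<i> * of_real t * h) - 1) / h))
    \<le> 4 / Im z * norm (exp (2 * of_real pi * \<i> * of_real t * Complex 0 (Im z / 4)))"
proof -
  define y where "y = Im z"
  have y: "y > 0" using z by (simp add: y_def)
  have "norm (exp (2 * of_real pi * \<i> * of_real t * h) - 1)
      \<le> exp \<bar>2 * pi * t * Im h\<bar> * (2 * pi * t * norm h)"
    using Taylor_exp[of "2 * of_real pi * \<i> * of_real t * h" 0] t by (simp add: norm_mult abs_mult mult_ac)
  also have "\<dots> \<le> exp (pi * t * y) * (2 * pi * t * norm h)"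
  proof -
    have "\<bar>Im h\<bar> \<le> y / 2" using abs_Im_le_cmod[of h] h by (simp add: y_def)
    then have "2 * pi * t * \<bar>Im h\<bar> \<le> 2 * pi * t * (y / 2)" using t by (intro mult_left_mono) auto
    then show ?thesis using t by (intro mult_right_mono) (auto simp: abs_mult mult_ac)
  qed
  finally have "norm ((exp (2 * of_real pi * \<i> * of_real t * h) - 1) / h) \<le> exp (pi * t * y) * (2 * pi * t)"
    using h by (simp add: norm_divide pos_divide_le_eq mult.assoc)
  also have "2 * pi * t \<le> 4 / y * exp (pi * t * y / 2)"
    using exp_ge_add_one_self[of "pi * t * y / 2"] y by (simp add: field_simps)
  finally have "norm ((exp (2 * of_real pi * \<i> * of_real t * h) - 1) / h)
      \<le> exp (pi * t * y) * (4 / y * exp (pi * t * y / 2))" by simp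
  then have "exp (- (2 * pi * t * y)) * norm ((exp (2 * of_real pi * \<i> * of_real t * h) - 1) / h)
      \<le> exp (- (2 * pi * t * y)) * (exp (pi * t * y) * (4 / y * exp (pi * t * y / 2)))"
    by (rule mult_left_mono) simp
  also have "\<dots> = 4 / y * exp (- (2 * pi * t * y) + pi * t * y + pi * t * y / 2)"
    by (simp only: exp_add mult_ac)
  also have "- (2 * pi * t * y) + pi * t * y + pi * t * y / 2 = - (2 * pi * t * (y / 4))" by simp
  finally have "exp (- (2 * pi * t * y)) * norm ((exp (2 * of_real pi * \<i> * of_real t * h) - 1) / h)
      \<le> 4 / y * exp (- (2 * pi * t * (y / 4)))" .
  moreover have "norm (exp (2 * of_real pi * \<i> * of_real t * z)) = exp (- (2 * pi * t * y))"
    "norm (exp (2 * of_real pi * \<i> * of_real t * Complex 0 (y / 4))) = exp (- (2 * pi * t * (y / 4)))"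
    by (simp_all add: y_def)
  ultimately show ?thesis by (simp only: norm_mult y_def[symmetric])
qed

text \<open>Differentiation under the integral sign by dominated convergence; the majorant is
  \<open>f\<close> times a Laplace kernel at a lower point, integrable by
  \<open>laplace_integrable\<close>.\<close>

lemma laplace_holomorphic:
  assumes p: "p \<ge> 1" and f: "f \<in> Lp_space lebesgue_pos p"
  shows "laplace f holomorphic_on upper_half_plane"
proof -
  define E where "E z t = exp (2 * of_real pi * \<i> * of_real t * z)" for z :: complex and t :: real
  have fm: "f \<in> borel_measurable lebesgue_pos" using f by (simp add: Lp_space_def)
  have cont: "k \<in> borel_measurable lebesgue_pos" if "continuous_on UNIV k" for k :: "real \<Rightarrow> complex"
    using that by (intro measurable_restrict_space1 measurable_completion)
      (simp add: borel_measurable_continuous_onI)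
  have int: "integrable lebesgue_pos (\<lambda>t. f t * E z t)" if "Im z > 0" for z
    unfolding E_def using laplace_integrable[OF p f] that by (simp add: upper_half_plane_def)
  have "\<exists>D. (laplace f has_field_derivative D) (at z)" if z: "Im z > 0" for z
  proof -
    define s where "s t = f t * (E z t * (2 * of_real pi * \<i> * of_real t))" for t
    define S where "S h t = f t * (E z t * ((E h t - 1) / h))" for h t
    \<comment> \<open>The radius keeps \<open>z + h\<close> in the half-plane and fits
      \<open>difference_quotient_exp_bound\<close>.\<close>
    define B where "B = ball (0::complex) (Im z / 2)"
    have quot: "(laplace f (z + h) - laplace f z) / h = (LINT t|lebesgue_pos. S h t)" if "h \<in> B" for h
    proof -
      have "Im (z + h) > 0" using that z abs_Im_le_cmod[of h] by (simp add: B_def)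
      then have "laplace f (z + h) - laplace f z = (LINT t|lebesgue_pos. f t * E (z + h) t - f t * E z t)"
        unfolding laplace_def E_def[symmetric] using z
        by (intro Bochner_Integration.integral_diff[symmetric] int)
      then have "(laplace f (z + h) - laplace f z) / h = (LINT t|lebesgue_pos. (f t * E (z + h) t - f t * E z t) / h)"
        by simp
      also have "\<dots> = (LINT t|lebesgue_pos. S h t)"
        by (intro Bochner_Integration.integral_cong)
          (auto simp: S_def E_def distrib_left exp_add diff_divide_distrib right_diff_distrib)
      finally show ?thesis .
    qed
    have "((\<lambda>h. (laplace f (z + h) - laplace f z) / h) \<longlongrightarrow> (LINT t|lebesgue_pos. s t)) (at 0 within B)"
      unfolding tendsto_at_iff_sequentially comp_def
    proof (intro allI impI)
      fix X :: "nat \<Rightarrow> complex"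
      assume XB: "\<forall>i. X i \<in> B - {0}" and X: "X \<longlonglongrightarrow> 0"
      have "(\<lambda>i. LINT t|lebesgue_pos. S (X i) t) \<longlonglongrightarrow> (LINT t|lebesgue_pos. s t)"
      proof (rule integral_dominated_convergence)
        show "s \<in> borel_measurable lebesgue_pos"
          unfolding s_def E_def
          by (rule borel_measurable_times[OF fm cont]) (intro continuous_intros)
        show "S (X i) \<in> borel_measurable lebesgue_pos" for i
          unfolding S_def E_def using XB
          by (intro borel_measurable_times[OF fm cont]) (auto intro!: continuous_on_mult continuous_on_divide continuous_on_diff continuous_on_exp continuous_on_of_real continuous_on_const continuous_on_id)
        have "Im (Complex 0 (Im z / 4)) > 0" using z by simp
        then show "integrable lebesgue_pos (\<lambda>t. 4 / Im z * norm (f t * E (Complex 0 (Im z / 4)) t))"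
          by (intro integrable_mult_right integrable_norm int)
        have "((\<lambda>h. (E h t - 1) / h) \<longlongrightarrow> 2 * of_real pi * \<i> * of_real t) (at 0)" for t
        proof -
          have "((\<lambda>h. E h t) has_field_derivative 2 * of_real pi * \<i> * of_real t) (at 0)"
            unfolding E_def by (auto intro!: derivative_eq_intros)
          then show ?thesis by (simp add: DERIV_def E_def)
        qed
        moreover have "filterlim X (at 0) sequentially"
          using X XB by (simp add: filterlim_at)
        ultimately have "(\<lambda>i. (E (X i) t - 1) / X i) \<longlonglongrightarrow> 2 * of_real pi * \<i> * of_real t" for t
          by (rule filterlim_compose)
        then show "AE t in lebesgue_pos. (\<lambda>i. S (X i) t) \<longlonglongrightarrow> s t"
          unfolding S_def s_def by (intro AE_I2 tendsto_mult tendsto_const)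
        show "AE t in lebesgue_pos. norm (S (X i) t) \<le> 4 / Im z * norm (f t * E (Complex 0 (Im z / 4)) t)" for i
        proof (rule AE_I2)
          fix t assume "t \<in> space lebesgue_pos"
          then have t: "t > 0" by simp
          have "norm (E z t * ((E (X i) t - 1) / X i)) \<le> 4 / Im z * norm (E (Complex 0 (Im z / 4)) t)"
            unfolding E_def using XB by (intro difference_quotient_exp_bound t z) (auto simp: B_def)
          then have "norm (f t) * norm (E z t * ((E (X i) t - 1) / X i))
            \<le> norm (f t) * (4 / Im z * norm (E (Complex 0 (Im z / 4)) t))"
            by (rule mult_left_mono) simp
          then show "norm (S (X i) t) \<le> 4 / Im z * norm (f t * E (Complex 0 (Im z / 4)) t)"
            unfolding S_def norm_mult[of "f t"] by (simp only: mult.left_commute)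
        qed
      qed
      then show "(\<lambda>i. (laplace f (z + X i) - laplace f z) / X i) \<longlonglongrightarrow> (LINT t|lebesgue_pos. s t)"
        using XB by (simp add: quot)
    qed
    moreover have "at 0 within B = at 0"
      using z by (intro at_within_open) (auto simp: B_def)
    ultimately show ?thesis unfolding DERIV_def by auto
  qed
  moreover have "open upper_half_plane"
    unfolding upper_half_plane_def by (rule open_halfspace_Im_gt)
  ultimately show ?thesis
    by (subst holomorphic_on_open) (auto simp: upper_half_plane_def)
qed

section \<open>Horizontal lines and the final estimate\<close>

lemma laplace_eq_fourier:
  assumes p: "p \<ge> 1" and f: "f \<in> Lp_space lebesgue_pos p" and y: "y > 0"
    and g[measurable]: "g \<in> borel_measurable borel" and g0: "\<And>t. t \<le> 0 \<Longrightarrow> g t = 0"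
    and eq: "AE t in lborel. t > 0 \<longrightarrow> g t = f t"
  shows "laplace f (Complex x y) = fourier (\<lambda>t. g t * of_real (exp (- (2 * pi * y * t)))) x"
proof -
  have e: "exp (2 * of_real pi * \<i> * of_real t * Complex x y)
      = of_real (exp (- (2 * pi * y * t))) * iexp (2 * pi * t * x)" for t
    unfolding exp_of_real[symmetric] mult_exp_exp
    by (rule arg_cong[of _ _ exp]) (simp add: complex_eq_iff)
  have meas: "(\<lambda>t. f t * exp (2 * of_real pi * \<i> * of_real t * Complex x y)) \<in> borel_measurable lebesgue_pos"
    by (rule borel_measurable_integrable[OF laplace_integrable[OF p f]]) (use y in \<open>simp add: upper_half_plane_def\<close>)
  have "laplace f (Complex x y) = (CLINT t|lborel. g t * exp (2 * of_real pi * \<i> * of_real t * Complex x y))"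
    unfolding laplace_def
    by (rule lebesgue_pos_transfer(2)[where H = "\<lambda>t w. w * exp (2 * of_real pi * \<i> * of_real t * Complex x y)",
          OF eq g0 _ meas, symmetric]) (simp_all add: e)
  then show ?thesis unfolding fourier_def e by (simp only: mult.assoc)
qed

theorem theorem1p2:
  fixes p q :: real
  assumes "2 < p" and "p \<le> q"
  shows "\<exists>C>0. \<forall>f \<in> Lp_space lebesgue_pos p.
           laplace f \<in> bergman_space q (q / conjugate_exponent p - 2) \<and>
           bergman_norm q (q / conjugate_exponent p - 2) (laplace f) \<le> C * Lp_norm lebesgue_pos p f"
proof -
  \<comment> \<open>The constant is fixed before \<open>g\<close>, so it is uniform over all
    functions.\<close>
  have "\<exists>C. \<forall>g. g \<in> borel_measurable borel \<longrightarrow> (\<forall>t\<le>0. g t = 0) \<longrightarrow> integrable lborel (\<lambda>t. norm (g t) powr p) \<longrightarrow>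
      (\<integral>\<^sup>+y\<in>{0<..}. (\<integral>\<^sup>+x. ennreal (norm (fourier (\<lambda>t. g t * of_real (exp (- (2 * pi * y * t)))) x) powr q
      * y powr (q - q / p - 2)) \<partial>lborel) \<partial>lborel)
    \<le> ennreal (C * (LINT t|lborel. norm (g t) powr p) powr (q / p))"
    by (intro exI allI impI) (rule damped_fourier_bound[OF assms]; simp)
  then obtain C' where bound: "\<And>g. g \<in> borel_measurable borel \<Longrightarrow> \<forall>t\<le>0. g t = 0 \<Longrightarrow> integrable lborel (\<lambda>t. norm (g t) powr p) \<Longrightarrow>
      (\<integral>\<^sup>+y\<in>{0<..}. (\<integral>\<^sup>+x. ennreal (norm (fourier (\<lambda>t. g t * of_real (exp (- (2 * pi * y * t)))) x) powr q
      * y powr (q - q / p - 2)) \<partial>lborel) \<partial>lborel)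
    \<le> ennreal (C' * (LINT t|lborel. norm (g t) powr p) powr (q / p))"
    by blast
  \<comment> \<open>Nothing is recorded about the sign of \<open>C'\<close>; the root taken below
    uses a nonnegative constant.\<close>
  define C where "C = max 0 C'"
  have C: "C \<ge> 0" by (simp add: C_def)
  define \<beta> where "\<beta> = q / conjugate_exponent p - 2"
  have \<beta>: "\<beta> = q - q / p - 2" using assms by (simp add: \<beta>_def conjugate_exponent_def field_simps)
  \<comment> \<open>Adding \<open>1\<close> keeps the constant positive even if
    \<open>C = 0\<close>.\<close>
  have "laplace f \<in> bergman_space q \<beta> \<and>
      bergman_norm q \<beta> (laplace f) \<le> (C powr (1 / q) + 1) * Lp_norm lebesgue_pos p f"
    if f: "f \<in> Lp_space lebesgue_pos p" for f
  proof -
    define A where "A = (LINT t|lebesgue_pos. norm (f t) powr p)"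
    have A0: "A \<ge> 0" by (simp add: A_def)
    have p1: "p \<ge> 1" using assms by simp
    have fm: "f \<in> borel_measurable lebesgue_pos" and fi: "integrable lebesgue_pos (\<lambda>t. norm (f t) powr p)"
      using f by (auto simp: Lp_space_def)
    from borel_representative[OF fm] obtain g where g[measurable]: "g \<in> borel_measurable borel"
      and g0: "\<And>t. t \<le> 0 \<Longrightarrow> g t = 0" and eq: "AE t in lborel. t > 0 \<longrightarrow> g t = f t" by blast
    note transfer = lebesgue_pos_transfer[where H = "\<lambda>t w. norm w powr p",
        OF eq g0 _ borel_measurable_integrable[OF fi]]
    have gi: "integrable lborel (\<lambda>t. norm (g t) powr p)"
      by (rule iffD2[OF transfer(1) fi]) simp_all
    have gA: "(LINT t|lborel. norm (g t) powr p) = A"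
      unfolding A_def by (rule transfer(2)) simp_all
    have "bergman_integral q \<beta> (laplace f) =
      (\<integral>\<^sup>+y\<in>{0<..}. (\<integral>\<^sup>+x. ennreal (norm (fourier (\<lambda>t. g t * of_real (exp (- (2 * pi * y * t)))) x) powr q
      * y powr (q - q / p - 2)) \<partial>lborel) \<partial>lborel)"
      unfolding bergman_integral_def \<beta>
    proof (rule nn_integral_cong)
      fix y :: real
      show "(\<integral>\<^sup>+x. ennreal (norm (laplace f (Complex x y)) powr q * y powr (q - q / p - 2)) \<partial>lborel) * indicator {0<..} y
        = (\<integral>\<^sup>+x. ennreal (norm (fourier (\<lambda>t. g t * of_real (exp (- (2 * pi * y * t)))) x) powr q
          * y powr (q - q / p - 2)) \<partial>lborel) * indicator {0<..} y"
        by (cases "y > 0") (simp_all add: laplace_eq_fourier[OF p1 f _ g g0 eq])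
    qed
    also have "\<dots> \<le> ennreal (C' * A powr (q / p))"
      using bound[OF g _ gi] g0 unfolding gA by simp
    also have "\<dots> \<le> ennreal (C * A powr (q / p))"
      by (intro ennreal_leI mult_right_mono) (simp_all add: C_def)
    finally have le: "bergman_integral q \<beta> (laplace f) \<le> ennreal (C * A powr (q / p))" .
    then have fin: "bergman_integral q \<beta> (laplace f) < \<infinity>"
      by (rule order_le_less_trans) simp
    have "enn2real (bergman_integral q \<beta> (laplace f)) \<le> C * A powr (q / p)"
      using le C by (intro enn2real_leI) auto
    then have "bergman_norm q \<beta> (laplace f) \<le> (C * A powr (q / p)) powr (1 / q)"
      unfolding bergman_norm_def using assms by (intro powr_mono2) auto
    also have "\<dots> = C powr (1 / q) * Lp_norm lebesgue_pos p f"
      using C assms by (simp add: powr_mult powr_powr Lp_norm_def A_def)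
    also have "\<dots> \<le> (C powr (1 / q) + 1) * Lp_norm lebesgue_pos p f"
      by (intro mult_right_mono) (auto simp: Lp_norm_def)
    finally show ?thesis
      using fin laplace_holomorphic[OF p1 f] by (simp add: bergman_space_def)
  qed
  moreover have "C powr (1 / q) + 1 > 0" by (simp add: add_nonneg_pos)
  ultimately show ?thesis unfolding \<beta>_def by blast
qed

end
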